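(* Let $G$ be a (not necessarily finite) group with Cayley table $L$ (rows and columns indexed by $G$, cell $(g,h)$ containing $gh$). Let $m$ be a positive integer and let $R$ be the submatrix of $L$ with rows indexed by a finite set $X\subseteq G$ and columns indexed by a finite set $Y\subseteq G$, where $|X|=\alpha m$, $|Y|=\beta m$ and $\frac12<\alpha\le\beta\le 1$, and suppose $R$ contains exactly $m$ distinct symbols. If $\frac{\alpha}{2}+\beta>1$, then $R$ is contained in an $m\times m$ subsquare of $L$.
   Context: An $m\times m$ subsquare of $L$ is a submatrix of $L$, with rows indexed by some $X'\subseteq G$ and columns indexed by some $Y'\subseteq G$, $|X'|=|Y'|=m$, which is itself a Latin square of order $m$ (i.e., contains exactly $m$ distinct symbols). $R$ is contained in it if $X\subseteq X'$ and $Y\subseteq Y'$. *)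

theory Defs
  imports Complex_Main "HOL-Algebra.Group"
begin

text \<open>
  A matrix is a function of a row index and a column index; a submatrix is given by such a
  function together with a set of row indices and a set of column indices.
\<close>

definition cayley_table :: "('a, 'b) monoid_scheme \<Rightarrow> 'a \<Rightarrow> 'a \<Rightarrow> 'a" where
  "cayley_table G = (\<lambda>g h. g \<otimes>\<^bsub>G\<^esub> h)"

definition symbols :: "('r \<Rightarrow> 'c \<Rightarrow> 's) \<Rightarrow> 'r set \<Rightarrow> 'c set \<Rightarrow> 's set" where
  "symbols M X Y = {M x y | x y. x \<in> X \<and> y \<in> Y}"

definition latin_square :: "nat \<Rightarrow> ('r \<Rightarrow> 'c \<Rightarrow> 's) \<Rightarrow> 'r set \<Rightarrow> 'c set \<Rightarrow> bool" where
  "latin_square m M X Y \<longleftrightarrow>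
     finite X \<and> card X = m \<and> finite Y \<and> card Y = m \<and>
     finite (symbols M X Y) \<and> card (symbols M X Y) = m \<and>
     (\<forall>s \<in> symbols M X Y. (\<forall>x \<in> X. \<exists>!y. y \<in> Y \<and> M x y = s) \<and>
                          (\<forall>y \<in> Y. \<exists>!x. x \<in> X \<and> M x y = s))"

definition cayley_subsquare :: "('a, 'b) monoid_scheme \<Rightarrow> nat \<Rightarrow> 'a set \<Rightarrow> 'a set \<Rightarrow> bool" where
  "cayley_subsquare G m X' Y' \<longleftrightarrow>
     X' \<subseteq> carrier G \<and> Y' \<subseteq> carrier G \<and> latin_square m (cayley_table G) X' Y'"

end

theory Submission
  imports Defs "HOL-Algebra.Coset"
begin

text \<open>
  Two left translates of \<open>Y\<close> by elements of \<open>X\<close> lie in the \<open>m\<close>-element set \<open>X Y\<close>, so every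
  \<open>d \<in> X\<^sup>-\<^sup>1 X\<close> satisfies \<open>|d Y \<inter> Y| \<ge> 2|Y| - m > 0\<close>; by the symmetric argument
  \<open>X\<^sup>-\<^sup>1 X = Y Y\<^sup>-\<^sup>1 =: H\<close>. The hypotheses force \<open>|Y| > 2m/3\<close>, so for \<open>d, e \<in> H\<close> the sets \<open>d Y \<inter> Y\<close>
  and \<open>e Y \<inter> Y\<close> meet inside \<open>Y\<close>, whence \<open>d\<^sup>-\<^sup>1 e \<in> Y Y\<^sup>-\<^sup>1\<close> and \<open>H\<close> is a subgroup.
  Counting \<open>Y \<times> Y\<close> by quotients gives \<open>|H| (2|Y| - m) \<le> |Y|\<^sup>2\<close>, which forces \<open>|H| < |X| + |Y|\<close>;
  then \<open>X Y\<close> fills a whole double coset \<open>x H y\<close>, so \<open>|H| = m\<close> and \<open>x H\<close>, \<open>H y\<close> index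
  the desired subsquare.
\<close>

section \<open>Cardinalities of intersections, translates and products\<close>

lemma symbols_cayley_table: "symbols (cayley_table G) X Y = X <#>\<^bsub>G\<^esub> Y"
  by (auto simp: symbols_def cayley_table_def set_mult_def)

lemma card_add_le_card_Int:
  assumes "finite C" "A \<subseteq> C" "B \<subseteq> C"
  shows "card A + card B \<le> card C + card (A \<inter> B)"
proof -
  have "finite A" "finite B" using assms by (auto intro: finite_subset)
  then have "card A + card B = card (A \<union> B) + card (A \<inter> B)" by (rule card_Un_Int)
  also have "card (A \<union> B) \<le> card C" using assms by (intro card_mono) auto
  finally show ?thesis by simp
qed

lemma (in group) card_l_coset:
  assumes "a \<in> carrier G" "B \<subseteq> carrier G"
  shows "card (a <# B) = card B"
proof -
  have "a <# B = (\<lambda>b. a \<otimes> b) ` B" by (auto simp: l_coset_def)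
  moreover have "inj_on (\<lambda>b. a \<otimes> b) B" using assms by (auto simp: inj_on_def subset_iff)
  ultimately show ?thesis by (simp add: card_image)
qed

lemma (in group) card_r_coset:
  assumes "a \<in> carrier G" "B \<subseteq> carrier G"
  shows "card (B #> a) = card B"
proof -
  have "B #> a = (\<lambda>b. b \<otimes> a) ` B" by (auto simp: r_coset_def)
  moreover have "inj_on (\<lambda>b. b \<otimes> a) B" using assms by (auto simp: inj_on_def subset_iff)
  ultimately show ?thesis by (simp add: card_image)
qed

lemma (in group) finite_set_mult:
  assumes "finite A" "finite B"
  shows "finite (A <#> B)"
  using assms by (auto simp: set_mult_def)

section \<open>Overlapping translates and the set of quotients\<close>

text \<open>Both \<open>x <# B\<close> and \<open>x' <# B\<close> lie in \<open>A <#> B\<close> and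
  have \<open>card B\<close> elements, which bounds their intersection from below; left translation
  by \<open>inv x\<close> carries it into the overlap on the right. The bound is quantitative
  because it is used twice: to show that overlaps exceed half of \<open>B\<close>, and to bound the
  number of quotients.\<close>

lemma (in group) card_l_coset_overlap:
  assumes A: "A \<subseteq> carrier G" "finite A" and B: "B \<subseteq> carrier G" "finite B"
    and x: "x \<in> A" "x' \<in> A"
  shows "2 * card B \<le> card (A <#> B) + card (((inv x \<otimes> x') <# B) \<inter> B)"
proof -
  have xc: "x \<in> carrier G" "x' \<in> carrier G" using A x by auto
  have "card (x' <# B) + card (x <# B) \<le> card (A <#> B) + card ((x' <# B) \<inter> (x <# B))"
    using x A B by (intro card_add_le_card_Int finite_set_mult) (auto simp: l_coset_def set_mult_def)
  moreover have "inv x <# ((x' <# B) \<inter> (x <# B)) \<subseteq> ((inv x \<otimes> x') <# B) \<inter> B"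
  proof
    fix z assume "z \<in> inv x <# ((x' <# B) \<inter> (x <# B))"
    then obtain b b' where b: "b \<in> B" "b' \<in> B" "x' \<otimes> b = x \<otimes> b'" "z = inv x \<otimes> (x' \<otimes> b)"
      by (auto simp: l_coset_def)
    have bc: "b \<in> carrier G" "b' \<in> carrier G" using b B by auto
    have "z = b'" using b xc bc by (simp add: m_assoc[symmetric])
    moreover have "z = inv x \<otimes> x' \<otimes> b" using b(4) xc bc by (simp add: m_assoc)
    ultimately show "z \<in> ((inv x \<otimes> x') <# B) \<inter> B" using b by (auto simp: l_coset_def)
  qed
  moreover have "finite (((inv x \<otimes> x') <# B) \<inter> B)" using B by simp
  moreover have "(x' <# B) \<inter> (x <# B) \<subseteq> carrier G"
    using l_coset_subset_G[OF B(1) xc(1)] by auto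
  ultimately show ?thesis
    using card_l_coset[of x B] card_l_coset[of x' B]
      card_l_coset[of "inv x" "(x' <# B) \<inter> (x <# B)"] xc B
      card_mono[of "((inv x \<otimes> x') <# B) \<inter> B" "inv x <# ((x' <# B) \<inter> (x <# B))"]
    by simp
qed

text \<open>\<open>A #> b\<close> and \<open>A #> b'\<close> each fill more than half of
  \<open>A <#> B\<close>, so they share an element.\<close>

lemma (in group) right_translates_meet:
  assumes A: "A \<subseteq> carrier G" "finite A" and B: "B \<subseteq> carrier G" "finite B"
    and "card (A <#> B) < 2 * card A" and b: "b \<in> B" "b' \<in> B"
  shows "\<exists>a\<in>A. \<exists>a'\<in>A. a \<otimes> b = a' \<otimes> b'"
proof -
  have "card (A #> b) + card (A #> b') \<le> card (A <#> B) + card ((A #> b) \<inter> (A #> b'))"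
    using b A B by (intro card_add_le_card_Int finite_set_mult) (auto simp: r_coset_def set_mult_def)
  moreover have "b \<in> carrier G" "b' \<in> carrier G" using b B by auto
  ultimately have "card ((A #> b) \<inter> (A #> b')) \<noteq> 0"
    using card_r_coset[of b A] card_r_coset[of b' A] A assms(5) by simp
  then have "(A #> b) \<inter> (A #> b') \<noteq> {}" by (metis card.empty)
  then show ?thesis by (auto simp: r_coset_def)
qed

text \<open>An equation \<open>a \<otimes> b = a' \<otimes> b'\<close> identifies the left quotient
  \<open>inv a' \<otimes> a\<close> with the right quotient \<open>b' \<otimes> inv b\<close>. The
  two size conditions provide such an equation for any given pair from \<open>A\<close> and for any
  given pair from \<open>B\<close>, respectively.\<close>

lemma (in group) left_quotients_eq_right_quotients:
  assumes A: "A \<subseteq> carrier G" "finite A" and B: "B \<subseteq> carrier G" "finite B"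
    and cA: "card (A <#> B) < 2 * card A" and cB: "card (A <#> B) < 2 * card B"
  shows "set_inv A <#> A = B <#> set_inv B"
proof (intro equalityI subsetI)
  fix g assume "g \<in> set_inv A <#> A"
  then obtain x x' where x: "x \<in> A" "x' \<in> A" and g: "g = inv x \<otimes> x'"
    by (auto simp: set_mult_def SET_INV_def)
  have "card ((g <# B) \<inter> B) \<noteq> 0"
    using card_l_coset_overlap[OF A B x] cB g by simp
  then have "(g <# B) \<inter> B \<noteq> {}" by (metis card.empty)
  then obtain b b' where b: "b \<in> B" "b' \<in> B" "b' = g \<otimes> b" by (auto simp: l_coset_def)
  have "g \<in> carrier G" "b \<in> carrier G" using x g A b B by auto
  then have "g = b' \<otimes> inv b" using b by (simp add: m_assoc)
  then show "g \<in> B <#> set_inv B" using b by (auto simp: set_mult_def SET_INV_def)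
next
  fix g assume "g \<in> B <#> set_inv B"
  then obtain b b' where b: "b \<in> B" "b' \<in> B" and g: "g = b \<otimes> inv b'"
    by (auto simp: set_mult_def SET_INV_def)
  obtain a a' where a: "a \<in> A" "a' \<in> A" "a \<otimes> b = a' \<otimes> b'"
    using right_translates_meet[OF A B cA b] by auto
  have c: "a \<in> carrier G" "a' \<in> carrier G" "b \<in> carrier G" "b' \<in> carrier G"
    using a b A B by auto
  have "b = inv a \<otimes> (a' \<otimes> b')" using a(3) c by (metis inv_solve_left m_closed)
  then have "g = inv a \<otimes> a'" using g c by (simp add: m_assoc)
  then show "g \<in> set_inv A <#> A" using a by (auto simp: set_mult_def SET_INV_def)
qed

text \<open>Two subsets of \<open>B\<close> that each exceed half of it must meet. A common point
  \<open>d \<otimes> b = e \<otimes> b'\<close> of the overlaps for \<open>d\<close> and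
  \<open>e\<close> exhibits \<open>inv d \<otimes> e\<close> as a quotient of elements of
  \<open>B\<close>.\<close>

lemma (in group) subgroup_right_quotients:
  assumes B: "B \<subseteq> carrier G" "finite B" "B \<noteq> {}"
    and overlap: "\<And>d. d \<in> B <#> set_inv B \<Longrightarrow> card B < 2 * card ((d <# B) \<inter> B)"
  shows "subgroup (B <#> set_inv B) G"
proof -
  let ?H = "B <#> set_inv B"
  have memI: "b \<otimes> inv b' \<in> ?H" if "b \<in> B" "b' \<in> B" for b b'
    using that by (auto simp: set_mult_def SET_INV_def)
  have sub: "?H \<subseteq> carrier G" using B by (auto simp: set_mult_def SET_INV_def)
  have quot: "inv d \<otimes> e \<in> ?H" if d: "d \<in> ?H" and e: "e \<in> ?H" for d e
  proof -
    have "card ((d <# B) \<inter> B) + card ((e <# B) \<inter> B)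
        \<le> card B + card (((d <# B) \<inter> B) \<inter> ((e <# B) \<inter> B))"
      using B by (intro card_add_le_card_Int) auto
    then have "card (((d <# B) \<inter> B) \<inter> ((e <# B) \<inter> B)) \<noteq> 0"
      using overlap[OF d] overlap[OF e] by linarith
    then have "((d <# B) \<inter> B) \<inter> ((e <# B) \<inter> B) \<noteq> {}" by (metis card.empty)
    then obtain b b' where b: "b \<in> B" "b' \<in> B" "d \<otimes> b = e \<otimes> b'" by (auto simp: l_coset_def)
    have c: "d \<in> carrier G" "e \<in> carrier G" "b \<in> carrier G" "b' \<in> carrier G"
      using b B d e sub by auto
    have "b = inv d \<otimes> (e \<otimes> b')" using b(3) c by (metis inv_solve_left m_closed)
    then have "inv d \<otimes> e = b \<otimes> inv b'" using c by (simp add: m_assoc)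
    then show ?thesis using memI b by simp
  qed
  have one: "\<one> \<in> ?H"
  proof -
    obtain b where "b \<in> B" using B by auto
    then show ?thesis using memI[of b b] B by auto
  qed
  have inv: "inv d \<in> ?H" if "d \<in> ?H" for d
    using quot[OF that one] that sub by auto
  show ?thesis
  proof (rule subgroupI)
    fix d e assume "d \<in> ?H" "e \<in> ?H"
    then show "d \<otimes> e \<in> ?H" using quot[OF inv, of d e] sub by auto
  qed (use sub one inv in auto)
qed

text \<open>Sort the pairs \<open>(c, b)\<close> of \<open>B \<times> B\<close> by their quotient
  \<open>d = c \<otimes> inv b\<close>. The pairs with quotient \<open>d\<close> correspond to the
  points \<open>c\<close> of \<open>(d <# B) \<inter> B\<close>, since
  \<open>b = inv d \<otimes> c\<close> is then determined.\<close>

lemma (in group) sum_card_l_coset_overlap: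
  assumes B: "B \<subseteq> carrier G" "finite B"
  shows "(\<Sum>d\<in>B <#> set_inv B. card ((d <# B) \<inter> B)) = card B ^ 2"
proof -
  let ?H = "B <#> set_inv B"
  have fin: "finite ?H" using B by (auto simp: set_mult_def SET_INV_def)
  have sub: "?H \<subseteq> carrier G" using B by (auto simp: set_mult_def SET_INV_def)
  have "bij_betw (\<lambda>(d, c). (c, inv d \<otimes> c)) (SIGMA d:?H. (d <# B) \<inter> B) (B \<times> B)"
  proof (rule bij_betwI[where g = "\<lambda>(c, b). (c \<otimes> inv b, c)"])
    show "(\<lambda>(d, c). (c, inv d \<otimes> c)) \<in> (SIGMA d:?H. (d <# B) \<inter> B) \<rightarrow> B \<times> B"
    proof clarsimp
      fix d c assume "d \<in> ?H" "c \<in> d <# B"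
      moreover from this obtain b where "b \<in> B" "c = d \<otimes> b" by (auto simp: l_coset_def)
      ultimately show "inv d \<otimes> c \<in> B" using sub B by (auto simp: m_assoc[symmetric] subset_iff)
    qed
    show "(\<lambda>(c, b). (c \<otimes> inv b, c)) \<in> B \<times> B \<rightarrow> (SIGMA d:?H. (d <# B) \<inter> B)"
    proof clarsimp
      fix c b assume cb: "c \<in> B" "b \<in> B"
      then have "c = c \<otimes> inv b \<otimes> b" using B by (auto simp: m_assoc subset_iff)
      then show "c \<otimes> inv b \<in> ?H \<and> c \<in> (c \<otimes> inv b) <# B"
        using cb by (auto simp: set_mult_def SET_INV_def l_coset_def)
    qed
  next
    fix p assume "p \<in> (SIGMA d:?H. (d <# B) \<inter> B)"
    then obtain d c where p: "p = (d, c)" "d \<in> ?H" "c \<in> B" by auto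
    then have "d \<in> carrier G" "c \<in> carrier G" using sub B by auto
    then show "(\<lambda>(c, b). (c \<otimes> inv b, c)) ((\<lambda>(d, c). (c, inv d \<otimes> c)) p) = p"
      using p by (simp add: inv_mult_group m_assoc[symmetric])
  next
    fix p assume "p \<in> B \<times> B"
    then obtain c b where p: "p = (c, b)" "c \<in> B" "b \<in> B" by auto
    then have "c \<in> carrier G" "b \<in> carrier G" using B by auto
    then show "(\<lambda>(d, c). (c, inv d \<otimes> c)) ((\<lambda>(c, b). (c \<otimes> inv b, c)) p) = p"
      using p by (simp add: inv_mult_group m_assoc)
  qed
  then have "card (SIGMA d:?H. (d <# B) \<inter> B) = card (B \<times> B)" by (rule bij_betw_same_card)
  then show ?thesis using fin B by (simp add: card_cartesian_product power2_eq_square)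
qed

section \<open>Double cosets and the subsquares they carry\<close>

text \<open>Solving \<open>x \<otimes> y = s\<close> in the group for one factor stays inside the
  cosets: with \<open>s = a \<otimes> k \<otimes> b\<close>, the factor
  \<open>x = a \<otimes> h\<close> leaves \<open>inv h \<otimes> k \<otimes> b\<close>, and
  \<open>y = h \<otimes> b\<close> leaves \<open>a \<otimes> (k \<otimes> inv h)\<close>.\<close>

lemma (in group) double_coset_quotients:
  assumes H: "subgroup H G" and a: "a \<in> carrier G" and b: "b \<in> carrier G"
    and s: "s \<in> (a <# H) #> b"
  shows "x \<in> a <# H \<Longrightarrow> inv x \<otimes> s \<in> H #> b"
    and "y \<in> H #> b \<Longrightarrow> s \<otimes> inv y \<in> a <# H"
proof -
  have HG: "H \<subseteq> carrier G" using H by (rule subgroup.subset)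
  obtain k where k: "k \<in> H" "s = a \<otimes> k \<otimes> b" using s by (auto simp: l_coset_def r_coset_def)
  have kc: "k \<in> carrier G" using k HG by auto
  show "inv x \<otimes> s \<in> H #> b" if x: "x \<in> a <# H"
  proof -
    obtain h where h: "h \<in> H" "x = a \<otimes> h" using x by (auto simp: l_coset_def)
    have hc: "h \<in> carrier G" using h HG by auto
    have "h \<otimes> (inv h \<otimes> (k \<otimes> b)) = k \<otimes> b" using hc kc b by (simp add: m_assoc[symmetric])
    then have "x \<otimes> (inv h \<otimes> k \<otimes> b) = s" using h(2) k(2) hc kc a b by (simp add: m_assoc)
    then have "inv x \<otimes> s = inv h \<otimes> k \<otimes> b"
      using h(2) hc kc a b by (metis inv_solve_left' m_closed inv_closed)
    then show ?thesis
      using subgroup.m_closed[OF H subgroup.m_inv_closed[OF H h(1)] k(1)] by (auto simp: r_coset_def)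
  qed
  show "s \<otimes> inv y \<in> a <# H" if y: "y \<in> H #> b"
  proof -
    obtain h where h: "h \<in> H" "y = h \<otimes> b" using y by (auto simp: r_coset_def)
    have hc: "h \<in> carrier G" using h HG by auto
    have "inv h \<otimes> (h \<otimes> b) = b" using hc b by (simp add: m_assoc[symmetric])
    then have "a \<otimes> (k \<otimes> inv h) \<otimes> y = s" using h(2) k(2) hc kc a b by (simp add: m_assoc)
    then have "s \<otimes> inv y = a \<otimes> (k \<otimes> inv h)"
      using h(2) hc kc a b by (metis inv_solve_right' m_closed inv_closed)
    then show ?thesis
      using subgroup.m_closed[OF H k(1) subgroup.m_inv_closed[OF H h(1)]] by (auto simp: l_coset_def)
  qed
qed

text \<open>Pigeonhole: for fixed \<open>s\<close>, the injection sending \<open>x\<close> to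
  \<open>inv x \<otimes> s\<close> maps \<open>A\<close> into \<open>H #> b\<close>, which has
  \<open>card H\<close> elements and also contains \<open>B\<close>. The image therefore meets
  \<open>B\<close>, giving a factorization of \<open>s\<close>.\<close>

lemma (in group) double_coset_subset_set_mult:
  assumes H: "subgroup H G" "finite H" and a: "a \<in> carrier G" and b: "b \<in> carrier G"
    and A: "A \<subseteq> a <# H" and B: "B \<subseteq> H #> b" and card: "card H < card A + card B"
  shows "(a <# H) #> b \<subseteq> A <#> B"
proof
  fix s assume s: "s \<in> (a <# H) #> b"
  have HG: "H \<subseteq> carrier G" using H(1) by (rule subgroup.subset)
  have aH: "a <# H \<subseteq> carrier G" using HG a by (rule l_coset_subset_G)
  have Ac: "A \<subseteq> carrier G" using A aH by auto
  have sc: "s \<in> carrier G" using s r_coset_subset_G[OF aH b] by auto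
  have fin: "finite (H #> b)" using H(2) by (auto simp: r_coset_def)
  let ?f = "\<lambda>x. inv x \<otimes> s"
  have "inj_on ?f A" using Ac sc by (auto simp: inj_on_def subset_iff intro: inj_onD[OF inv_inj])
  then have "card (?f ` A) = card A" by (rule card_image)
  moreover have "card (?f ` A) + card B \<le> card (H #> b) + card (?f ` A \<inter> B)"
    using fin A B double_coset_quotients(1)[OF H(1) a b s]
    by (intro card_add_le_card_Int) auto
  ultimately have "card (?f ` A \<inter> B) \<noteq> 0" using card card_r_coset[OF b HG] by simp
  then have "?f ` A \<inter> B \<noteq> {}" by (metis card.empty)
  then obtain x where x: "x \<in> A" "?f x \<in> B" by auto
  then have "s = x \<otimes> ?f x" using Ac sc by (auto simp: m_assoc[symmetric] subset_iff)
  then show "s \<in> A <#> B" using x by (auto simp: set_mult_def)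
qed

lemma (in group) set_mult_cosets:
  assumes H: "subgroup H G" and a: "a \<in> carrier G" and b: "b \<in> carrier G"
  shows "(a <# H) <#> (H #> b) = (a <# H) #> b"
proof -
  have HG: "H \<subseteq> carrier G" using H by (rule subgroup.subset)
  have "(a <# H) <#> (H #> b) = (a <# (H <#> H)) #> b"
    using HG a b by (simp add: setmult_rcos_assoc setmult_lcos_assoc l_coset_subset_G)
  then show ?thesis using H by (simp add: subgroup_mult_id)
qed

text \<open>The symbols form \<open>(a <# H) #> b\<close>, again of size \<open>card H\<close>. Each
  row and column equation has a unique solution in the group, and
  \<open>double_coset_quotients\<close> places it in the required coset.\<close>

lemma (in group) cayley_subsquare_cosets:
  assumes H: "subgroup H G" "finite H" and a: "a \<in> carrier G" and b: "b \<in> carrier G"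
  shows "cayley_subsquare G (card H) (a <# H) (H #> b)"
proof -
  have HG: "H \<subseteq> carrier G" using H(1) by (rule subgroup.subset)
  have aH: "a <# H \<subseteq> carrier G" using HG a by (rule l_coset_subset_G)
  have Hb: "H #> b \<subseteq> carrier G" using HG b by (rule r_coset_subset_G)
  have aHb: "(a <# H) #> b \<subseteq> carrier G" using aH b by (rule r_coset_subset_G)
  have fin: "finite (a <# H)" "finite (H #> b)" "finite ((a <# H) #> b)"
    using H(2) by (auto simp: l_coset_def r_coset_def)
  have cards: "card (a <# H) = card H" "card (H #> b) = card H" "card ((a <# H) #> b) = card H"
    using a b HG aH by (simp_all add: card_l_coset card_r_coset)
  have col: "\<exists>!y. y \<in> H #> b \<and> x \<otimes> y = s" if x: "x \<in> a <# H" and s: "s \<in> (a <# H) #> b" for x s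
  proof (rule ex1I[of _ "inv x \<otimes> s"])
    have c: "x \<in> carrier G" "s \<in> carrier G" using x s aH aHb by auto
    show "inv x \<otimes> s \<in> H #> b \<and> x \<otimes> (inv x \<otimes> s) = s"
      using double_coset_quotients(1)[OF H(1) a b s x] c by (simp add: m_assoc[symmetric])
    fix y assume "y \<in> H #> b \<and> x \<otimes> y = s"
    then show "y = inv x \<otimes> s" using c Hb by (auto simp: m_assoc[symmetric])
  qed
  have row: "\<exists>!x. x \<in> a <# H \<and> x \<otimes> y = s" if y: "y \<in> H #> b" and s: "s \<in> (a <# H) #> b" for y s
  proof (rule ex1I[of _ "s \<otimes> inv y"])
    have c: "y \<in> carrier G" "s \<in> carrier G" using y s Hb aHb by auto
    show "s \<otimes> inv y \<in> a <# H \<and> s \<otimes> inv y \<otimes> y = s"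
      using double_coset_quotients(2)[OF H(1) a b s y] c by (simp add: m_assoc)
    fix x assume "x \<in> a <# H \<and> x \<otimes> y = s"
    then show "x = s \<otimes> inv y" using c aH by (auto simp: m_assoc)
  qed
  show ?thesis
    using aH Hb fin cards row col
    by (simp add: cayley_subsquare_def latin_square_def symbols_cayley_table
        set_mult_cosets[OF H(1) a b]) (simp add: cayley_table_def)
qed

section \<open>The numerical bound and the conclusion\<close>

lemma less_add_of_mult_le_square:
  fixes m x y h :: nat
  assumes "x \<le> y" "y \<le> m" "2 * m < x + 2 * y" and le: "h * (2 * y - m) \<le> y\<^sup>2"
  shows "h < x + y"
proof (rule ccontr)
  assume "\<not> h < x + y"
  \<comment> \<open>The hypothesis gives \<open>x \<ge> 2 * m - 2 * y + 1\<close>, so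
    \<open>x + y\<close>, and hence \<open>h\<close>, is at least
    \<open>2 * m - y + 1\<close>.\<close>
  then have h: "2 * int m - int y + 1 \<le> int h" using assms(3) by linarith
  have pos: "0 < 2 * int y - int m" using assms by linarith
  have "int (h * (2 * y - m)) \<le> int (y\<^sup>2)" using le by (rule of_nat_mono)
  then have "int h * (2 * int y - int m) \<le> (int y)\<^sup>2"
    using pos by simp
  moreover have "(2 * int m - int y + 1) * (2 * int y - int m) \<le> int h * (2 * int y - int m)"
    using h pos by (intro mult_right_mono) auto
  \<comment> \<open>This product equals \<open>(2 * m - y) * (2 * y - m) - y\<^sup>2\<close>. The
    extra 1 in the bound on \<open>h\<close> contributes the positive term \<open>2 * y - m\<close>,
    which makes the contradiction strict. The first factor is nonnegative because
    \<open>x \<le> y\<close> forces \<open>3 * y > 2 * m\<close>.\<close>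
  moreover have "0 \<le> (3 * int y - 2 * int m) * (int m - int y)"
    using assms by (intro mult_nonneg_nonneg) auto
  ultimately show False using pos by (simp add: algebra_simps power2_eq_square)
qed

text \<open>The theorem in natural numbers: its conditions on \<alpha> and \<beta> are multiplied by
  \<open>m\<close> and cleared of denominators.\<close>

lemma (in group) cayley_subsquare_if_small_set_mult:
  assumes X: "X \<subseteq> carrier G" "finite X" and Y: "Y \<subseteq> carrier G" "finite Y"
    and m: "card (X <#> Y) = m"
    and "m < 2 * card X" "card X \<le> card Y" "card Y \<le> m" "2 * m < card X + 2 * card Y"
  shows "\<exists>X' Y'. cayley_subsquare G m X' Y' \<and> X \<subseteq> X' \<and> Y \<subseteq> Y'"
proof -
  let ?H = "Y <#> set_inv Y"
  have H_eq: "set_inv X <#> X = ?H"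
    using assms by (intro left_quotients_eq_right_quotients) auto
  have overlap: "2 * card Y - m \<le> card ((d <# Y) \<inter> Y)" if "d \<in> ?H" for d
  proof -
    have "d \<in> set_inv X <#> X" using that H_eq by simp
    then obtain x x' where "x \<in> X" "x' \<in> X" "d = inv x \<otimes> x'"
      by (auto simp: set_mult_def SET_INV_def)
    then show ?thesis using card_l_coset_overlap[OF X Y, of x x'] m by simp
  qed
  have "X \<noteq> {}" "Y \<noteq> {}" using assms by auto
  then obtain a b where a: "a \<in> X" and b: "b \<in> Y" by auto
  have ac: "a \<in> carrier G" and bc: "b \<in> carrier G" using a b X Y by auto
  have H: "subgroup ?H G"
  proof (rule subgroup_right_quotients)
    \<comment> \<open>Since \<open>3 * card Y > 2 * m\<close>, the bound
      \<open>2 * card Y - m\<close> exceeds half of \<open>card Y\<close>.\<close>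
    show "card Y < 2 * card ((d <# Y) \<inter> Y)" if "d \<in> ?H" for d
      using overlap[OF that] assms by linarith
  qed (use Y \<open>Y \<noteq> {}\<close> in auto)
  have fin: "finite ?H" using Y by (auto simp: set_mult_def SET_INV_def)
  have "card ?H * (2 * card Y - m) \<le> (\<Sum>d\<in>?H. card ((d <# Y) \<inter> Y))"
    using sum_bounded_below[of ?H "2 * card Y - m"] overlap by simp
  then have small: "card ?H < card X + card Y"
    using less_add_of_mult_le_square[of "card X" "card Y" m "card ?H"] assms
    by (simp add: sum_card_l_coset_overlap[OF Y])
  have X': "X \<subseteq> a <# ?H"
  proof
    fix x assume x: "x \<in> X"
    then have "inv a \<otimes> x \<in> ?H" using a unfolding H_eq[symmetric]
      by (auto simp: set_mult_def SET_INV_def)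
    moreover have "x = a \<otimes> (inv a \<otimes> x)" using x X ac by (auto simp: m_assoc[symmetric] subset_iff)
    ultimately show "x \<in> a <# ?H" by (auto simp: l_coset_def)
  qed
  have Y': "Y \<subseteq> ?H #> b"
  proof
    fix y assume y: "y \<in> Y"
    then have "y \<otimes> inv b \<in> ?H" using b by (auto simp: set_mult_def SET_INV_def)
    moreover have "y = (y \<otimes> inv b) \<otimes> b" using y Y bc by (auto simp: m_assoc subset_iff)
    ultimately show "y \<in> ?H #> b" by (auto simp: r_coset_def)
  qed
  have "X <#> Y \<subseteq> (a <# ?H) #> b"
    using mono_set_mult[OF X' Y', of G] set_mult_cosets[OF H ac bc] by simp
  \<comment> \<open>As \<open>X\<close> and \<open>Y\<close> together outnumber \<open>?H\<close>,
    their product reaches every element of the double coset; comparing sizes then identifies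
    \<open>card ?H\<close> with \<open>m\<close>.\<close>
  then have "X <#> Y = (a <# ?H) #> b"
    using double_coset_subset_set_mult[OF H fin ac bc X' Y' small] by auto
  then have "card ?H = m"
    using m ac bc subgroup.subset[OF H] by (simp add: card_l_coset card_r_coset l_coset_subset_G)
  then show ?thesis
    using cayley_subsquare_cosets[OF H fin ac bc] X' Y' by auto
qed

theorem theorem4p8:
  fixes G (structure) and m :: nat and X Y :: "'a set" and \<alpha> \<beta> :: real
  assumes "group G"
    and "m > 0"
    and "X \<subseteq> carrier G" and "finite X"
    and "Y \<subseteq> carrier G" and "finite Y"
    and "real (card X) = \<alpha> * real m"
    and "real (card Y) = \<beta> * real m"
    and "1 / 2 < \<alpha>" and "\<alpha> \<le> \<beta>" and "\<beta> \<le> 1"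
    and "card (symbols (cayley_table G) X Y) = m"
    and "\<alpha> / 2 + \<beta> > 1"
  shows "\<exists>X' Y'. cayley_subsquare G m X' Y' \<and> X \<subseteq> X' \<and> Y \<subseteq> Y'"
proof (rule group.cayley_subsquare_if_small_set_mult)
  show "card (X <#> Y) = m" using assms by (simp add: symbols_cayley_table)
  have m: "0 < real m" using assms by simp
  have "1 / 2 * real m < \<alpha> * real m" using assms m by (intro mult_strict_right_mono)
  then show "m < 2 * card X" using assms by linarith
  have "\<alpha> * real m \<le> \<beta> * real m" using assms m by (intro mult_right_mono) auto
  then show "card X \<le> card Y" using assms by linarith
  have "\<beta> * real m \<le> 1 * real m" using assms m by (intro mult_right_mono) auto
  then show "card Y \<le> m" using assms by linarith
  have "1 * real m < (\<alpha> / 2 + \<beta>) * real m" using assms m by (intro mult_strict_right_mono)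
  then have "1 * real m < \<alpha> * real m / 2 + \<beta> * real m" by (simp add: algebra_simps)
  then show "2 * m < card X + 2 * card Y" using assms by linarith
qed (use assms in auto)

end
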